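(* Let $W$ be the complex Lie algebra with basis $\{L_m, I_m \mid m\in\mathbb{Z}\}$ and bracket $[L_m,L_n]=(m-n)L_{m+n}$, $[L_m,I_n]=(m-n)I_{m+n}$, $[I_m,I_n]=0$ for all $m,n\in\mathbb{Z}$. Then $$H^1(W,W)=\mathbb{C}D,$$ where $D$ is the derivation of $W$ given by $D(L_m)=0$, $D(I_m)=I_m$ for all $m\in\mathbb{Z}$; that is, $H^1(W,W)$ is one-dimensional, spanned by the class of $D$.
   Context: For a Lie algebra $\mathfrak g$ and a $\mathfrak g$-module $V$, a derivation $D:\mathfrak g\to V$ is a linear map with $D[x,y]=x.D(y)-y.D(x)$ for all $x,y\in\mathfrak g$; it is inner if there is $v\in V$ with $D(x)=x.v$ for all $x$. $Der(\mathfrak g,V)$ and $Inn(\mathfrak g,V)$ are the vector spaces of derivations and inner derivations, and $H^1(\mathfrak g,V)=Der(\mathfrak g,V)/Inn(\mathfrak g,V)$. In $H^1(W,W)$ the coefficient module is the adjoint module. *)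

theory Defs
  imports
    "Jordan_Normal_Form.VS_Connect"
    "HOL-Algebra.AbelCoset"
    "HOL-Library.Poly_Mapping"
    "HOL-Library.Product_Plus"
begin

section \<open>Quotients of carrier-based vector spaces\<close>

text \<open>The scalar multiple of a coset is written as a union over representatives, so that no
  choice is involved; \<open>quotient_smult_coset\<close> below gives the usual formula.\<close>

definition quotient_space ::
    "('k, 'v, 'm) module_scheme \<Rightarrow> 'v set \<Rightarrow> ('k, 'v set) module" where
  "quotient_space V U =
     \<lparr>carrier = a_rcosets\<^bsub>V\<^esub> U, mult = undefined, one = undefined,
      zero = U, add = (\<lambda>X Y. X <+>\<^bsub>V\<^esub> Y),
      smult = (\<lambda>c X. \<Union>x\<in>X. U +>\<^bsub>V\<^esub> (c \<odot>\<^bsub>V\<^esub> x))\<rparr>"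

lemma quotient_space_simps:
  "carrier (quotient_space V U) = a_rcosets\<^bsub>V\<^esub> U"
  "zero (quotient_space V U) = U"
  "add (quotient_space V U) = (\<lambda>X Y. X <+>\<^bsub>V\<^esub> Y)"
  "smult (quotient_space V U) = (\<lambda>c X. \<Union>x\<in>X. U +>\<^bsub>V\<^esub> (c \<odot>\<^bsub>V\<^esub> x))"
  by (simp_all add: quotient_space_def)

lemma subspace_abelian_subgroup:
  assumes "VectorSpace.subspace K U V"
  shows "abelian_subgroup U V"
proof -
  interpret V: vectorspace K V using assms by (simp add: VectorSpace.subspace_def)
  interpret U: submodule K U V using assms by (simp add: VectorSpace.subspace_def)
  have inv: "\<ominus>\<^bsub>V\<^esub> x \<in> U" if "x \<in> U" for x
  proof -
    have xV: "x \<in> carrier V" using that U.subset by auto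
    have "(\<ominus>\<^bsub>K\<^esub> \<one>\<^bsub>K\<^esub>) \<odot>\<^bsub>V\<^esub> x \<in> U" using that by (intro U.smult_closed) auto
    moreover have "(\<ominus>\<^bsub>K\<^esub> \<one>\<^bsub>K\<^esub>) \<odot>\<^bsub>V\<^esub> x = \<ominus>\<^bsub>V\<^esub> x"
      using xV by (simp add: V.smult_l_minus)
    ultimately show ?thesis by simp
  qed
  have "U \<noteq> {}" using U.zero_closed by blast
  then have "subgroup U (add_monoid V)"
    using U.subset inv by (intro V.add.subgroupI) (auto simp: a_inv_def)
  then have "additive_subgroup U V" by (rule additive_subgroupI)
  then show ?thesis by (intro abelian_subgroupI3 V.abelian_group_axioms)
qed

lemma quotient_smult_coset:
  assumes sub: "VectorSpace.subspace K U V" and c: "c \<in> carrier K" and x: "x \<in> carrier V"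
  shows "c \<odot>\<^bsub>quotient_space V U\<^esub> (U +>\<^bsub>V\<^esub> x) = U +>\<^bsub>V\<^esub> (c \<odot>\<^bsub>V\<^esub> x)"
proof -
  interpret V: vectorspace K V using sub by (simp add: VectorSpace.subspace_def)
  interpret U: submodule K U V using sub by (simp add: VectorSpace.subspace_def)
  interpret A: abelian_subgroup U V using sub by (rule subspace_abelian_subgroup)
  have eq: "U +>\<^bsub>V\<^esub> (c \<odot>\<^bsub>V\<^esub> y) = U +>\<^bsub>V\<^esub> (c \<odot>\<^bsub>V\<^esub> x)" if y: "y \<in> U +>\<^bsub>V\<^esub> x" for y
  proof -
    obtain u where u: "u \<in> U" "y = u \<oplus>\<^bsub>V\<^esub> x" using y by (auto simp: a_r_coset_def')
    have uV: "u \<in> carrier V" using u U.subset by auto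
    have "c \<odot>\<^bsub>V\<^esub> y = c \<odot>\<^bsub>V\<^esub> u \<oplus>\<^bsub>V\<^esub> c \<odot>\<^bsub>V\<^esub> x" using u uV c x by (simp add: V.smult_r_distr)
    moreover have "c \<odot>\<^bsub>V\<^esub> u \<in> U" using c u by auto
    ultimately have "c \<odot>\<^bsub>V\<^esub> y \<in> U +>\<^bsub>V\<^esub> (c \<odot>\<^bsub>V\<^esub> x)" by (auto simp: a_r_coset_def')
    then show ?thesis
      by (rule A.a_repr_independence'[symmetric]) (use c x in simp)
  qed
  have "x \<in> U +>\<^bsub>V\<^esub> x" using x by (rule A.a_rcos_self)
  then have ne: "U +>\<^bsub>V\<^esub> x \<noteq> {}" by blast
  have "c \<odot>\<^bsub>quotient_space V U\<^esub> (U +>\<^bsub>V\<^esub> x) = (\<Union>y\<in>U +>\<^bsub>V\<^esub> x. U +>\<^bsub>V\<^esub> (c \<odot>\<^bsub>V\<^esub> y))"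
    by (simp only: quotient_space_simps)
  also have "\<dots> = (\<Union>y\<in>U +>\<^bsub>V\<^esub> x. U +>\<^bsub>V\<^esub> (c \<odot>\<^bsub>V\<^esub> x))"
    using eq by (intro SUP_cong refl)
  finally show ?thesis using ne by (simp only: UN_constant if_False)
qed

lemma quotient_space_vectorspace:
  assumes sub: "VectorSpace.subspace K U V"
  shows "vectorspace K (quotient_space V U)"
proof -
  interpret V: vectorspace K V using sub by (simp add: VectorSpace.subspace_def)
  interpret A: abelian_subgroup U V using sub by (rule subspace_abelian_subgroup)
  let ?Q = "quotient_space V U"
  note smult = quotient_smult_coset[OF sub]
  have cos: "\<exists>x\<in>carrier V. X = U +>\<^bsub>V\<^esub> x" if "X \<in> carrier ?Q" for X
    using that by (auto simp: quotient_space_simps A_RCOSETS_def')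
  have mem: "U +>\<^bsub>V\<^esub> x \<in> carrier ?Q" if "x \<in> carrier V" for x
    using that by (auto simp: quotient_space_simps A_RCOSETS_def')
  have add: "(U +>\<^bsub>V\<^esub> x) \<oplus>\<^bsub>?Q\<^esub> (U +>\<^bsub>V\<^esub> y) = U +>\<^bsub>V\<^esub> (x \<oplus>\<^bsub>V\<^esub> y)"
    if "x \<in> carrier V" "y \<in> carrier V" for x y
    using that by (simp add: quotient_space_simps A.a_rcos_sum)
  have zero: "\<zero>\<^bsub>?Q\<^esub> = U +>\<^bsub>V\<^esub> \<zero>\<^bsub>V\<^esub>"
    using A.a_subset by (simp add: quotient_space_simps)
  have zero_mem: "\<zero>\<^bsub>?Q\<^esub> \<in> carrier ?Q" unfolding zero by (rule mem) simp
  have ab: "abelian_group ?Q"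
  proof (rule abelian_groupI)
    show "\<zero>\<^bsub>?Q\<^esub> \<in> carrier ?Q" by (rule zero_mem)
  next
    fix X Y assume "X \<in> carrier ?Q" "Y \<in> carrier ?Q"
    then obtain x y where "x \<in> carrier V" "y \<in> carrier V" "X = U +>\<^bsub>V\<^esub> x" "Y = U +>\<^bsub>V\<^esub> y"
      using cos by meson
    then show "X \<oplus>\<^bsub>?Q\<^esub> Y \<in> carrier ?Q" "X \<oplus>\<^bsub>?Q\<^esub> Y = Y \<oplus>\<^bsub>?Q\<^esub> X"
      by (simp_all add: add mem V.a_comm)
  next
    fix X Y Z assume "X \<in> carrier ?Q" "Y \<in> carrier ?Q" "Z \<in> carrier ?Q"
    then obtain x y z where "x \<in> carrier V" "y \<in> carrier V" "z \<in> carrier V"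
      "X = U +>\<^bsub>V\<^esub> x" "Y = U +>\<^bsub>V\<^esub> y" "Z = U +>\<^bsub>V\<^esub> z"
      using cos by meson
    then show "(X \<oplus>\<^bsub>?Q\<^esub> Y) \<oplus>\<^bsub>?Q\<^esub> Z = X \<oplus>\<^bsub>?Q\<^esub> (Y \<oplus>\<^bsub>?Q\<^esub> Z)"
      by (simp add: add V.a_assoc)
  next
    fix X assume "X \<in> carrier ?Q"
    then obtain x where x: "x \<in> carrier V" "X = U +>\<^bsub>V\<^esub> x" using cos by meson
    have "\<zero>\<^bsub>?Q\<^esub> \<oplus>\<^bsub>?Q\<^esub> X = U +>\<^bsub>V\<^esub> (\<zero>\<^bsub>V\<^esub> \<oplus>\<^bsub>V\<^esub> x)"
      unfolding zero x(2) by (rule add[OF V.zero_closed x(1)])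
    then show "\<zero>\<^bsub>?Q\<^esub> \<oplus>\<^bsub>?Q\<^esub> X = X" using x by (simp only: V.l_zero)
    have "(U +>\<^bsub>V\<^esub> (\<ominus>\<^bsub>V\<^esub> x)) \<oplus>\<^bsub>?Q\<^esub> X = U +>\<^bsub>V\<^esub> (\<ominus>\<^bsub>V\<^esub> x \<oplus>\<^bsub>V\<^esub> x)"
      unfolding x(2) by (rule add[OF V.a_inv_closed[OF x(1)] x(1)])
    then have "(U +>\<^bsub>V\<^esub> (\<ominus>\<^bsub>V\<^esub> x)) \<oplus>\<^bsub>?Q\<^esub> X = \<zero>\<^bsub>?Q\<^esub>"
      using x by (simp only: zero V.l_neg)
    then show "\<exists>Y\<in>carrier ?Q. Y \<oplus>\<^bsub>?Q\<^esub> X = \<zero>\<^bsub>?Q\<^esub>" using mem x(1) V.a_inv_closed by blast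
  qed
  have "module K ?Q"
  proof (rule moduleI[OF V.R.is_cring ab])
    fix a b X assume ab: "a \<in> carrier K" "b \<in> carrier K" and "X \<in> carrier ?Q"
    then obtain x where "x \<in> carrier V" "X = U +>\<^bsub>V\<^esub> x" using cos by meson
    with ab show "(a \<oplus>\<^bsub>K\<^esub> b) \<odot>\<^bsub>?Q\<^esub> X = a \<odot>\<^bsub>?Q\<^esub> X \<oplus>\<^bsub>?Q\<^esub> b \<odot>\<^bsub>?Q\<^esub> X"
      "(a \<otimes>\<^bsub>K\<^esub> b) \<odot>\<^bsub>?Q\<^esub> X = a \<odot>\<^bsub>?Q\<^esub> (b \<odot>\<^bsub>?Q\<^esub> X)"
      by (simp_all add: add smult V.smult_l_distr V.smult_assoc1)
  next
    fix a X Y assume a: "a \<in> carrier K" and "X \<in> carrier ?Q" "Y \<in> carrier ?Q"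
    then obtain x y where "x \<in> carrier V" "y \<in> carrier V" "X = U +>\<^bsub>V\<^esub> x" "Y = U +>\<^bsub>V\<^esub> y"
      using cos by meson
    with a show "a \<odot>\<^bsub>?Q\<^esub> (X \<oplus>\<^bsub>?Q\<^esub> Y) = a \<odot>\<^bsub>?Q\<^esub> X \<oplus>\<^bsub>?Q\<^esub> a \<odot>\<^bsub>?Q\<^esub> Y"
      by (simp add: add smult V.smult_r_distr)
  next
    fix a X assume a: "a \<in> carrier K" and "X \<in> carrier ?Q"
    then obtain x where "x \<in> carrier V" "X = U +>\<^bsub>V\<^esub> x" using cos by meson
    with a show "a \<odot>\<^bsub>?Q\<^esub> X \<in> carrier ?Q" by (simp add: smult mem)
  next
    fix X assume "X \<in> carrier ?Q"
    then obtain x where "x \<in> carrier V" "X = U +>\<^bsub>V\<^esub> x" using cos by meson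
    then show "\<one>\<^bsub>K\<^esub> \<odot>\<^bsub>?Q\<^esub> X = X" by (simp add: smult)
  qed
  then show ?thesis by (intro vectorspace.intro V.field_axioms)
qed

section \<open>Lie algebras, modules and first cohomology\<close>

locale lie_algebra = vector_space scale
  for scale :: "'k::field \<Rightarrow> 'g::ab_group_add \<Rightarrow> 'g" +
  fixes br :: "'g \<Rightarrow> 'g \<Rightarrow> 'g"
  assumes br_linear_left: "Vector_Spaces.linear scale scale (\<lambda>x. br x y)"
    and br_linear_right: "Vector_Spaces.linear scale scale (br x)"
    and br_self: "br x x = 0"
    and jacobi: "br x (br y z) + br y (br z x) + br z (br x y) = 0"

locale lie_module = g: lie_algebra sg br + v: vector_space sv
  for sg :: "'k::field \<Rightarrow> 'g::ab_group_add \<Rightarrow> 'g"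
    and br :: "'g \<Rightarrow> 'g \<Rightarrow> 'g"
    and sv :: "'k \<Rightarrow> 'v::ab_group_add \<Rightarrow> 'v" +
  fixes act :: "'g \<Rightarrow> 'v \<Rightarrow> 'v"
  assumes act_linear_left: "Vector_Spaces.linear sg sv (\<lambda>x. act x w)"
    and act_linear_right: "Vector_Spaces.linear sv sv (act x)"
    and act_bracket: "act (br x y) w = act x (act y w) - act y (act x w)"

context lie_algebra
begin

lemma br_simps:
  "br (x + y) z = br x z + br y z" "br (scale c x) z = scale c (br x z)"
  "br x (y + z) = br x y + br x z" "br x (scale c z) = scale c (br x z)"
  "br x (- z) = - br x z"
proof -
  show "br (x + y) z = br x z + br y z" "br (scale c x) z = scale c (br x z)"
    using br_linear_left[of z] by (simp_all add: Vector_Spaces.linear_iff)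
  show r: "br x (y + z) = br x y + br x z" "br x (scale c z) = scale c (br x z)" for y z c
    using br_linear_right[of x] by (simp_all add: Vector_Spaces.linear_iff)
  show "br x (- z) = - br x z" using r(2)[of "- 1" z] by simp
qed

lemma br_antisym: "br x y = - br y x"
proof -
  have "br (x + y) (x + y) = br x y + br y x"
    unfolding br_simps by (simp add: br_self)
  then have "br x y + br y x = 0" by (simp add: br_self)
  then show ?thesis by (simp add: eq_neg_iff_add_eq_0)
qed

lemma adjoint_module: "lie_module scale br scale br"
proof unfold_locales
  fix x y w
  have "br x (br y w) + br y (br w x) + br w (br x y) = 0" by (rule jacobi)
  moreover have "br y (br w x) = - br y (br x w)" by (metis br_antisym br_simps(5))
  moreover have "br w (br x y) = - br (br x y) w" by (rule br_antisym)
  ultimately show "br (br x y) w = br x (br y w) - br y (br x w)"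
    by (simp add: algebra_simps)
qed (simp_all add: br_simps)

end

text \<open>In all of the following, \<open>sg\<close> and \<open>br\<close> are the scalar multiplication and the bracket
  of the Lie algebra, \<open>sv\<close> and \<open>act\<close> the scalar multiplication and the action of the
  coefficient module.\<close>

definition derivations ::
    "('k::field \<Rightarrow> 'g::ab_group_add \<Rightarrow> 'g) \<Rightarrow> ('g \<Rightarrow> 'g \<Rightarrow> 'g) \<Rightarrow>
     ('k \<Rightarrow> 'v::ab_group_add \<Rightarrow> 'v) \<Rightarrow> ('g \<Rightarrow> 'v \<Rightarrow> 'v) \<Rightarrow> ('g \<Rightarrow> 'v) set" where
  "derivations sg br sv act =
     {D. Vector_Spaces.linear sg sv D \<and>
         (\<forall>x y. D (br x y) = act x (D y) - act y (D x))}"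

definition inner_derivations ::
    "('k::field \<Rightarrow> 'g::ab_group_add \<Rightarrow> 'g) \<Rightarrow> ('g \<Rightarrow> 'g \<Rightarrow> 'g) \<Rightarrow>
     ('k \<Rightarrow> 'v::ab_group_add \<Rightarrow> 'v) \<Rightarrow> ('g \<Rightarrow> 'v \<Rightarrow> 'v) \<Rightarrow> ('g \<Rightarrow> 'v) set" where
  "inner_derivations sg br sv act =
     {D \<in> derivations sg br sv act. \<exists>w. \<forall>x. D x = act x w}"

definition derivation_space ::
    "('k::field \<Rightarrow> 'g::ab_group_add \<Rightarrow> 'g) \<Rightarrow> ('g \<Rightarrow> 'g \<Rightarrow> 'g) \<Rightarrow>
     ('k \<Rightarrow> 'v::ab_group_add \<Rightarrow> 'v) \<Rightarrow> ('g \<Rightarrow> 'v \<Rightarrow> 'v) \<Rightarrow> ('k, 'g \<Rightarrow> 'v) module" where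
  "derivation_space sg br sv act =
     \<lparr>carrier = derivations sg br sv act, mult = undefined, one = undefined,
      zero = (\<lambda>x. 0), add = (\<lambda>D E x. D x + E x), smult = (\<lambda>c D x. sv c (D x))\<rparr>"

definition H1 ::
    "('k::field \<Rightarrow> 'g::ab_group_add \<Rightarrow> 'g) \<Rightarrow> ('g \<Rightarrow> 'g \<Rightarrow> 'g) \<Rightarrow>
     ('k \<Rightarrow> 'v::ab_group_add \<Rightarrow> 'v) \<Rightarrow> ('g \<Rightarrow> 'v \<Rightarrow> 'v) \<Rightarrow> ('k, ('g \<Rightarrow> 'v) set) module" where
  "H1 sg br sv act =
     quotient_space (derivation_space sg br sv act) (inner_derivations sg br sv act)"

definition H1_class ::
    "('k::field \<Rightarrow> 'g::ab_group_add \<Rightarrow> 'g) \<Rightarrow> ('g \<Rightarrow> 'g \<Rightarrow> 'g) \<Rightarrow>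
     ('k \<Rightarrow> 'v::ab_group_add \<Rightarrow> 'v) \<Rightarrow> ('g \<Rightarrow> 'v \<Rightarrow> 'v) \<Rightarrow> ('g \<Rightarrow> 'v) \<Rightarrow> ('g \<Rightarrow> 'v) set" where
  "H1_class sg br sv act D =
     inner_derivations sg br sv act +>\<^bsub>derivation_space sg br sv act\<^esub> D"

context lie_module
begin

lemma act_simps:
  "act (x + y) w = act x w + act y w" "act (sg c x) w = sv c (act x w)"
  "act x (w + w') = act x w + act x w'" "act x (sv c w) = sv c (act x w)" "act x 0 = 0"
proof -
  show "act (x + y) w = act x w + act y w" "act (sg c x) w = sv c (act x w)"
    using act_linear_left[of w] by (simp_all add: Vector_Spaces.linear_iff)
  show r: "act x (w + w') = act x w + act x w'" "act x (sv c w) = sv c (act x w)" for w w'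
    using act_linear_right[of x] by (simp_all add: Vector_Spaces.linear_iff)
  show "act x 0 = 0" using r(1)[of 0 0] by simp
qed

lemma derivation_iff:
  "D \<in> derivations sg br sv act \<longleftrightarrow>
     (\<forall>x y. D (x + y) = D x + D y) \<and> (\<forall>c x. D (sg c x) = sv c (D x)) \<and>
     (\<forall>x y. D (br x y) = act x (D y) - act y (D x))"
  unfolding derivations_def Vector_Spaces.linear_iff
  using g.vector_space_axioms v.vector_space_axioms by auto

lemma derivation_space_simps:
  "carrier (derivation_space sg br sv act) = derivations sg br sv act"
  "zero (derivation_space sg br sv act) = (\<lambda>x. 0)"
  "add (derivation_space sg br sv act) = (\<lambda>D E x. D x + E x)"
  "smult (derivation_space sg br sv act) = (\<lambda>c D x. sv c (D x))"
  by (simp_all add: derivation_space_def)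

lemma derivations_closed:
  "(\<lambda>x. 0) \<in> derivations sg br sv act"
  "D \<in> derivations sg br sv act \<Longrightarrow> E \<in> derivations sg br sv act \<Longrightarrow>
     (\<lambda>x. D x + E x) \<in> derivations sg br sv act"
  "D \<in> derivations sg br sv act \<Longrightarrow> (\<lambda>x. sv c (D x)) \<in> derivations sg br sv act"
  by (simp_all add: derivation_iff act_simps v.scale_right_distrib v.scale_right_diff_distrib
      v.scale_left_commute)

lemma derivation_space_vectorspace: "vectorspace class_ring (derivation_space sg br sv act)"
proof -
  let ?V = "derivation_space sg br sv act"
  have ab: "abelian_group ?V"
  proof (rule abelian_groupI)
    fix D assume D: "D \<in> carrier ?V"
    then have "(\<lambda>x. sv (- 1) (D x)) \<in> carrier ?V"
      using derivations_closed(3)[of D "- 1"] by (simp add: derivation_space_simps)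
    moreover have "(\<lambda>x. sv (- 1) (D x)) \<oplus>\<^bsub>?V\<^esub> D = \<zero>\<^bsub>?V\<^esub>"
      by (simp add: derivation_space_simps)
    ultimately show "\<exists>E\<in>carrier ?V. E \<oplus>\<^bsub>?V\<^esub> D = \<zero>\<^bsub>?V\<^esub>" by blast
  qed (auto simp: derivation_space_simps derivations_closed algebra_simps)
  have "module class_ring ?V"
    by (rule moduleI[OF _ ab])
       (auto simp: derivation_space_simps derivations_closed v.scale_right_distrib
          v.scale_left_distrib class_cring.is_cring)
  then show ?thesis by (intro vectorspace.intro class_field)
qed

lemma inner_derivations_subspace:
  "VectorSpace.subspace class_ring (inner_derivations sg br sv act)
     (derivation_space sg br sv act)"
proof -
  interpret V: vectorspace class_ring "derivation_space sg br sv act"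
    by (rule derivation_space_vectorspace)
  have "submodule class_ring (inner_derivations sg br sv act) (derivation_space sg br sv act)"
  proof (rule submodule.intro)
    show "module class_ring (derivation_space sg br sv act)" by (rule V.module_axioms)
    show "inner_derivations sg br sv act \<subseteq> carrier (derivation_space sg br sv act)"
      by (auto simp: inner_derivations_def derivation_space_simps)
    show "\<zero>\<^bsub>derivation_space sg br sv act\<^esub> \<in> inner_derivations sg br sv act"
      using act_simps(5) by (auto simp: inner_derivations_def derivation_space_simps
          derivations_closed intro!: exI[of _ 0])
    fix D E assume "D \<in> inner_derivations sg br sv act" "E \<in> inner_derivations sg br sv act"
    then show "D \<oplus>\<^bsub>derivation_space sg br sv act\<^esub> E \<in> inner_derivations sg br sv act"
      by (auto simp: inner_derivations_def derivation_space_simps derivations_closed)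
         (metis act_simps(3))
  next
    fix c D assume "D \<in> inner_derivations sg br sv act"
    then show "c \<odot>\<^bsub>derivation_space sg br sv act\<^esub> D \<in> inner_derivations sg br sv act"
      by (auto simp: inner_derivations_def derivation_space_simps derivations_closed)
         (metis act_simps(4))
  qed
  then show ?thesis using V.vectorspace_axioms by (simp add: VectorSpace.subspace_def)
qed

theorem H1_vectorspace: "vectorspace class_ring (H1 sg br sv act)"
  unfolding H1_def by (rule quotient_space_vectorspace[OF inner_derivations_subspace])

end

section \<open>The algebra \<open>W\<close>\<close>

locale W_algebra = lie_algebra scale br
  for scale :: "complex \<Rightarrow> 'w::ab_group_add \<Rightarrow> 'w" and br :: "'w \<Rightarrow> 'w \<Rightarrow> 'w" +
  fixes L I :: "int \<Rightarrow> 'w"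
  assumes inj_L: "inj L" and inj_I: "inj I" and L_I_disjoint: "range L \<inter> range I = {}"
    and basis_independent: "independent (range L \<union> range I)"
    and basis_span: "span (range L \<union> range I) = UNIV"
    and br_L_L: "br (L m) (L n) = scale (of_int (m - n)) (L (m + n))"
    and br_L_I: "br (L m) (I n) = scale (of_int (m - n)) (I (m + n))"
    and br_I_I: "br (I m) (I n) = 0"

subsection \<open>A model\<close>

text \<open>The locale is inhabited.  With \<open>t d/dt\<close> denoted by \<open>eder\<close>, Laurent polynomials
  with the bracket \<open>f' g - f g'\<close> form the Witt algebra with \<open>L\<^sub>m = t\<^sup>m\<close>; extending
  scalars to the dual numbers, with \<open>I\<^sub>m = \<epsilon> t\<^sup>m\<close>, gives \<open>W\<close>.  A pair \<open>(f, g)\<close> stands for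
  \<open>f + \<epsilon> g\<close>.\<close>

type_synonym laurent = "int \<Rightarrow>\<^sub>0 complex"

lift_definition eder :: "laurent \<Rightarrow> laurent" is "\<lambda>f k. of_int k * f k"
  by (erule finite_subset[rotated]) auto

lemma laurent_induct [case_names zero add]:
  fixes f :: laurent
  assumes "P 0" and "\<And>k c f. P f \<Longrightarrow> P (Poly_Mapping.single k c + f)"
  shows "P f"
proof (induction f rule: update_induct)
  case (update f a b)
  have "Poly_Mapping.update a b f = Poly_Mapping.single a b + f"
    using update(1)
    by (intro poly_mapping_eqI)
      (auto simp: Poly_Mapping.lookup_update Poly_Mapping.lookup_add Poly_Mapping.lookup_single when_def in_keys_iff)
  then show ?case using assms(2) update by simp
qed (use assms(1) in \<open>simp_all\<close>)

lemma eder_add: "eder (f + g) = eder f + eder g"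
  by transfer (simp add: fun_eq_iff algebra_simps)

lemma eder_zero: "eder 0 = 0"
  by transfer simp

lemma eder_diff: "eder (f - g) = eder f - eder g"
  by transfer (simp add: fun_eq_iff algebra_simps)

lemma eder_single: "eder (Poly_Mapping.single k c) = Poly_Mapping.single k (of_int k * c)"
  by transfer (auto simp: fun_eq_iff when_def)

lemma eder_mult: "eder (f * g) = eder f * g + f * eder g"
proof (induction f rule: laurent_induct)
  case (add k c f)
  have "eder (Poly_Mapping.single k c * g) =
          eder (Poly_Mapping.single k c) * g + Poly_Mapping.single k c * eder g" for k c
  proof (induction g rule: laurent_induct)
    case (add l d g)
    then show ?case
      by (simp add: distrib_left eder_add eder_single mult_single add_ac
          flip: single_add) (simp add: algebra_simps)
  qed (simp add: eder_zero)
  then show ?case using add by (simp add: distrib_right eder_add)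
qed (simp add: eder_zero)

definition model_scale :: "complex \<Rightarrow> laurent \<times> laurent \<Rightarrow> laurent \<times> laurent" where
  "model_scale c x = (Poly_Mapping.single 0 c * fst x, Poly_Mapping.single 0 c * snd x)"

definition model_br :: "laurent \<times> laurent \<Rightarrow> laurent \<times> laurent \<Rightarrow> laurent \<times> laurent" where
  "model_br x y =
     (eder (fst x) * fst y - fst x * eder (fst y),
      eder (fst x) * snd y - fst x * eder (snd y) + (eder (snd x) * fst y - snd x * eder (fst y)))"

lemma model_lie_algebra: "lie_algebra model_scale model_br"
proof -
  have const: "eder (Poly_Mapping.single 0 c) = 0" for c by (simp add: eder_single)
  have vs: "vector_space model_scale"
    by unfold_locales
      (simp_all add: model_scale_def prod_eq_iff algebra_simps single_add mult_single
        flip: mult.assoc)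
  show ?thesis
  proof (intro lie_algebra.intro vs lie_algebra_axioms.intro)
    show "Vector_Spaces.linear model_scale model_scale (\<lambda>x. model_br x y)" for y
      unfolding Vector_Spaces.linear_iff using vs
      by (auto simp: model_scale_def model_br_def eder_add eder_mult const algebra_simps)
    show "Vector_Spaces.linear model_scale model_scale (model_br x)" for x
      unfolding Vector_Spaces.linear_iff using vs
      by (auto simp: model_scale_def model_br_def eder_add eder_mult const algebra_simps)
    show "model_br x x = 0" for x
      by (simp add: model_br_def prod_eq_iff algebra_simps)
    show "model_br x (model_br y z) + model_br y (model_br z x) + model_br z (model_br x y) = 0"
      for x y z
      by (simp add: model_br_def prod_eq_iff eder_add eder_diff eder_mult algebra_simps)
  qed
qed

lemma model_W_algebra:
  "W_algebra model_scale model_br (\<lambda>m. (Poly_Mapping.single m 1, 0)) (\<lambda>m. (0, Poly_Mapping.single m 1))"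
  (is "W_algebra _ _ ?L ?I")
proof -
  interpret lie_algebra model_scale model_br by (rule model_lie_algebra)
  let ?B = "range ?L \<union> range ?I"
  have coord: "Poly_Mapping.lookup (Poly_Mapping.single 0 c * f) k = c * Poly_Mapping.lookup f k" for c k and f :: laurent
    by (induction f rule: laurent_induct)
      (auto simp: distrib_left Poly_Mapping.lookup_add mult_single Poly_Mapping.lookup_single when_def)
  have single_neq: "Poly_Mapping.single m (1::complex) \<noteq> 0" for m :: int
    by (metis Poly_Mapping.lookup_single_eq Poly_Mapping.lookup_zero zero_neq_one)
  have single_eq: "Poly_Mapping.single m (1::complex) = Poly_Mapping.single n 1 \<longleftrightarrow> m = n" for m n :: int
    by (metis Poly_Mapping.lookup_single_eq Poly_Mapping.lookup_single_not_eq zero_neq_one)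
  have fst0: "Poly_Mapping.lookup (fst x) m = 0" if "x \<in> span (?B - {?L m})" for x m
    using that
  proof (induction rule: span_induct_alt)
    case (step c x y)
    then show ?case
      by (auto simp: model_scale_def Poly_Mapping.lookup_add coord Poly_Mapping.lookup_single when_def split: if_splits)
  qed simp
  have snd0: "Poly_Mapping.lookup (snd x) m = 0" if "x \<in> span (?B - {?I m})" for x m
    using that
  proof (induction rule: span_induct_alt)
    case (step c x y)
    then show ?case
      by (auto simp: model_scale_def Poly_Mapping.lookup_add coord Poly_Mapping.lookup_single when_def split: if_splits)
  qed simp
  have ind: "independent ?B"
    unfolding dependent_def
  proof
    assume "\<exists>a\<in>?B. a \<in> span (?B - {a})"
    then obtain m where "?L m \<in> span (?B - {?L m}) \<or> ?I m \<in> span (?B - {?I m})" by blast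
    then show False using fst0[of "?L m" m] snd0[of "?I m" m] by auto
  qed
  have scaleL: "(Poly_Mapping.single k c, 0) = model_scale c (?L k)"
    and scaleI: "(0, Poly_Mapping.single k c) = model_scale c (?I k)" for k c
    by (simp_all add: model_scale_def mult_single)
  have L: "(f, 0) \<in> span ?B" for f
  proof (induction f rule: laurent_induct)
    case zero
    show ?case unfolding zero_prod_def[symmetric] by (rule span_zero)
  next
    case (add k c f)
    have "(Poly_Mapping.single k c, 0) \<in> span ?B"
      unfolding scaleL[of k c] by (intro span_scale span_base) blast
    from span_add[OF this add] show ?case by simp
  qed
  have I: "(0, f) \<in> span ?B" for f
  proof (induction f rule: laurent_induct)
    case zero
    show ?case unfolding zero_prod_def[symmetric] by (rule span_zero)
  next
    case (add k c f)
    have "(0, Poly_Mapping.single k c) \<in> span ?B"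
      unfolding scaleI[of k c] by (intro span_scale span_base) blast
    from span_add[OF this add] show ?case by simp
  qed
  have "x \<in> span ?B" for x
    using span_add[OF L[of "fst x"] I[of "snd x"]] by simp
  then have span: "span ?B = UNIV" by blast
  show ?thesis
  proof (intro W_algebra.intro W_algebra_axioms.intro lie_algebra_axioms ind span)
    show "inj ?L" "inj ?I" by (auto simp: inj_def single_eq)
    show "range ?L \<inter> range ?I = {}" using single_neq by auto
    fix m n
    show "model_br (?L m) (?L n) = model_scale (of_int (m - n)) (?L (m + n))"
      "model_br (?L m) (?I n) = model_scale (of_int (m - n)) (?I (m + n))"
      by (simp_all add: model_br_def model_scale_def eder_single eder_zero mult_single
          flip: single_diff del: single_of_int)
    show "model_br (?I m) (?I n) = 0"
      by (simp add: model_br_def eder_zero flip: zero_prod_def)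
  qed
qed

end

theory Submission
  imports Defs
begin

text \<open>Since \<open>ad L\<^sub>0\<close> acts with eigenvalue \<open>-n\<close> on \<open>L\<^sub>n\<close> and \<open>I\<^sub>n\<close>, its image together with \<open>L\<^sub>0\<close> and
  \<open>I\<^sub>0\<close> spans \<open>W\<close>.  Hence a derivation can be corrected by an inner one so that it sends \<open>L\<^sub>0\<close> into
  the zero eigenspace, and then it preserves degrees: \<open>L\<^sub>n\<close> goes to a combination of \<open>L\<^sub>n\<close> and
  \<open>I\<^sub>n\<close> whose coefficients are additive in \<open>n\<close>, so that the bracket with a combination of \<open>L\<^sub>0\<close> and
  \<open>I\<^sub>0\<close> removes them.  A derivation that kills every \<open>L\<^sub>n\<close> maps \<open>I\<^sub>n\<close> to \<open>p L\<^sub>n + q I\<^sub>n\<close> with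
  \<open>p, q\<close> independent of \<open>n\<close>, and \<open>[I\<^sub>1, I\<^sub>0] = 0\<close> forces \<open>p = 0\<close>.  Finally \<open>D\<close> is not inner because
  \<open>[I\<^sub>0, w]\<close> has no \<open>I\<^sub>0\<close> component.\<close>

section \<open>Additive functions on the integers and one-dimensional spaces\<close>

text \<open>Additivity is assumed only for \<open>m \<noteq> n\<close>, since it comes from a
  bracket identity with factor \<open>m - n\<close>. The missing value \<open>a 2\<close> follows by
  splitting 5 in two ways: \<open>1 + (1 + (1 + 2))\<close> gives \<open>3 * a 1 + a 2\<close>, and
  \<open>2 + (1 + 2)\<close> gives \<open>a 1 + 2 * a 2\<close>.\<close>

lemma int_partial_additive:
  fixes a :: "int \<Rightarrow> complex"
  assumes add: "\<And>m n. m \<noteq> n \<Longrightarrow> a (m + n) = a m + a n"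
  shows "a n = of_int n * a 1"
proof -
  have a0: "a 0 = 0" using add[of 1 0] by simp
  have "a 5 = a 1 + a 4" "a 4 = a 1 + a 3" "a 3 = a 1 + a 2" "a 5 = a 2 + a 3"
    using add[of 1 4] add[of 1 3] add[of 1 2] add[of 2 3] by simp_all
  then have a2: "a 2 = 2 * a 1" by (simp add: algebra_simps)
  have pos: "a (int k) = of_nat k * a 1" for k
  proof (induction k)
    case (Suc k)
    show ?case
    proof (cases "k = 1")
      case True
      then show ?thesis using a2 by simp
    next
      case False
      then show ?thesis using add[of "int k" 1] Suc by (simp add: algebra_simps)
    qed
  qed (simp add: a0)
  show ?thesis
  proof (cases "n = 0")
    case False
    have "a n = - a (- n)" using add[of n "- n"] a0 False by (simp add: eq_neg_iff_add_eq_0)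
    then show ?thesis
      using pos[of "nat n"] pos[of "nat (- n)"] by (cases "n \<ge> 0") auto
  qed (simp add: a0)
qed

lemma (in vectorspace) basis_singletonI:
  assumes v: "v \<in> carrier V" "v \<noteq> \<zero>\<^bsub>V\<^esub>"
    and gen: "\<And>x. x \<in> carrier V \<Longrightarrow> \<exists>c\<in>carrier K. x = c \<odot>\<^bsub>V\<^esub> v"
  shows "basis {v}" "dim = 1"
proof -
  have "lin_indpt {v}"
    using v by (metis empty_iff empty_subsetI finite.emptyI finite_lin_indpt2 insert_iff
        insert_subset insert_union lin_dep_iff_in_span span_empty)
  moreover have "span {v} = carrier V"
  proof
    show "span {v} \<subseteq> carrier V" using v by (intro span_is_subset2) simp
    show "carrier V \<subseteq> span {v}"
    proof
      fix x assume "x \<in> carrier V"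
      then obtain c where c: "c \<in> carrier K" "x = c \<odot>\<^bsub>V\<^esub> v" using gen by blast
      have "submodule K (span {v}) V" using v by (intro span_is_submodule) simp
      moreover have "v \<in> span {v}" using v in_own_span[of "{v}"] by simp
      ultimately show "x \<in> span {v}" using c by (simp add: submodule.smult_closed)
    qed
  qed
  ultimately show "basis {v}" using v by (simp add: basis_def)
  then show "dim = 1" using dim_basis[of "{v}"] by simp
qed

section \<open>Coordinates in the basis of \<open>W\<close>\<close>

context W_algebra
begin

text \<open>Reduces linear identities to basis vectors: elements are built by adding one scaled
  basis vector at a time.\<close>

lemma W_induct [case_names zero add_L add_I]:
  assumes "P 0"
    and "\<And>c m x. P x \<Longrightarrow> P (scale c (L m) + x)"
    and "\<And>c m x. P x \<Longrightarrow> P (scale c (I m) + x)"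
  shows "P x"
proof -
  have "x \<in> span (range L \<union> range I)" using basis_span by simp
  then show ?thesis by (induction rule: span_induct_alt) (use assms in auto)
qed

definition coord_L :: "int \<Rightarrow> 'w \<Rightarrow> complex" where
  "coord_L m x = representation (range L \<union> range I) x (L m)"

definition coord_I :: "int \<Rightarrow> 'w \<Rightarrow> complex" where
  "coord_I m x = representation (range L \<union> range I) x (I m)"

lemma L_neq_I: "L m \<noteq> I n" "I n \<noteq> L m"
  using L_I_disjoint by (metis IntI emptyE rangeI)+

lemma coord_simps [simp]:
  "coord_L k 0 = 0" "coord_I k 0 = 0"
  "coord_L k (x + y) = coord_L k x + coord_L k y"
  "coord_I k (x + y) = coord_I k x + coord_I k y"
  "coord_L k (scale c x) = c * coord_L k x"
  "coord_I k (scale c x) = c * coord_I k x"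
  "coord_L k (L m) = (if k = m then 1 else 0)"
  "coord_L k (I m) = 0"
  "coord_I k (L m) = 0"
  "coord_I k (I m) = (if k = m then 1 else 0)"
  using basis_independent basis_span inj_L inj_I
  by (auto simp: coord_L_def coord_I_def representation_zero representation_add
      representation_scale representation_basis L_neq_I inj_eq)

lemma coord_diff [simp]:
  "coord_L k (x - y) = coord_L k x - coord_L k y"
  "coord_I k (x - y) = coord_I k x - coord_I k y"
  using coord_simps(3,4)[of k "x - y" y] by simp_all

lemma coord_eqI:
  assumes "\<And>k. coord_L k x = coord_L k y" and "\<And>k. coord_I k x = coord_I k y"
  shows "x = y"
proof -
  have "representation (range L \<union> range I) x b = representation (range L \<union> range I) y b" for b
  proof (cases "b \<in> range L \<union> range I")
    case True
    then show ?thesis using assms by (auto simp: coord_L_def coord_I_def)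
  next
    case False
    then show ?thesis using representation_ne_zero[of _ _ b] by (metis (no_types, lifting))
  qed
  then have eq: "representation (range L \<union> range I) x = representation (range L \<union> range I) y"
    by (rule ext)
  have sum: "(\<Sum>b | representation (range L \<union> range I) z b \<noteq> 0.
      scale (representation (range L \<union> range I) z b) b) = z" for z
    using basis_span by (intro sum_nonzero_representation_eq[OF basis_independent]) simp
  show ?thesis using sum[of x] sum[of y] unfolding eq by simp
qed

section \<open>The spectral decomposition of \<open>ad L\<^sub>0\<close>\<close>

lemma br_I_L: "br (I m) (L n) = scale (of_int (m - n)) (I (m + n))"
  by (subst br_antisym) (simp add: br_L_I add.commute flip: scale_minus_left)

lemma br_zero [simp]: "br x 0 = 0" "br 0 x = 0"
  using br_simps(4)[of x 0 0] br_simps(2)[of 0 0 x] by simp_all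

lemma coord_br_L0:
  "coord_L k (br (L 0) x) = - of_int k * coord_L k x"
  "coord_I k (br (L 0) x) = - of_int k * coord_I k x"
  by (induction x rule: W_induct) (simp_all add: br_simps br_L_L br_L_I algebra_simps)

text \<open>Only \<open>[I\<^sub>0, L\<^sub>n] = -n I\<^sub>n\<close> can contribute, and its
  coefficient vanishes exactly at \<open>n = 0\<close>.\<close>

lemma coord_br_I0: "coord_I 0 (br (I 0) x) = 0"
  by (induction x rule: W_induct) (simp_all add: br_simps br_I_I br_I_L)

lemma br_diff: "br x (y - z) = br x y - br x z"
  using br_simps(3)[of x y "- z"] by (simp add: br_simps(5))

lemma ad_L0_decomposition: "\<exists>w a b. x = br (L 0) w + scale a (L 0) + scale b (I 0)"
proof (induction x rule: W_induct)
  case zero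
  show ?case by (intro exI[of _ 0]) simp
next
  case (add_L c m x)
  then obtain w a b where x: "x = br (L 0) w + scale a (L 0) + scale b (I 0)" by blast
  show ?case
  proof (cases "m = 0")
    case True
    have "scale c (L m) + x = br (L 0) w + scale (c + a) (L 0) + scale b (I 0)"
      by (simp add: x True scale_left_distrib)
    then show ?thesis by blast
  next
    case False
    \<comment> \<open>As \<open>[L\<^sub>0, L\<^sub>m] = -m L\<^sub>m\<close>, the preimage of
      \<open>c L\<^sub>m\<close> under \<open>ad L\<^sub>0\<close> has coefficient
      \<open>-c/m\<close>.\<close>
    have "scale c (L m) + x =
      br (L 0) (scale (- c / of_int m) (L m) + w) + scale a (L 0) + scale b (I 0)"
      using False by (simp add: x br_simps br_diff br_L_L)
    then show ?thesis by blast
  qed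
next
  case (add_I c m x)
  then obtain w a b where x: "x = br (L 0) w + scale a (L 0) + scale b (I 0)" by blast
  show ?case
  proof (cases "m = 0")
    case True
    have "scale c (I m) + x = br (L 0) w + scale a (L 0) + scale (c + b) (I 0)"
      by (simp add: x True scale_left_distrib)
    then show ?thesis by blast
  next
    case False
    have "scale c (I m) + x =
      br (L 0) (scale (- c / of_int m) (I m) + w) + scale a (L 0) + scale b (I 0)"
      using False by (simp add: x br_simps br_diff br_L_I)
    then show ?thesis by blast
  qed
qed

text \<open>Compare coordinates at \<open>k\<close>. At \<open>k = n\<close> the eigenvalue terms
  cancel and leave \<open>a\<close> and \<open>b\<close>; elsewhere the factor \<open>k - n\<close>
  kills the coordinate.\<close>

lemma ad_L0_eigenvector:
  assumes "br (L 0) x = scale (- of_int n) x + scale a (L n) + scale b (I n)"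
  shows "a = 0" "b = 0" "x = scale (coord_L n x) (L n) + scale (coord_I n x) (I n)"
proof -
  have l: "- of_int k * coord_L k x = - of_int n * coord_L k x + a * (if k = n then 1 else 0)"
    and i: "- of_int k * coord_I k x = - of_int n * coord_I k x + b * (if k = n then 1 else 0)" for k
    using arg_cong[OF assms, of "coord_L k"] arg_cong[OF assms, of "coord_I k"]
    by (simp_all only: coord_br_L0 coord_simps mult_zero_right add_0_right)
  show "a = 0" "b = 0" using l[of n] i[of n] by simp_all
  show "x = scale (coord_L n x) (L n) + scale (coord_I n x) (I n)"
  proof (rule coord_eqI)
    show "coord_L k x = coord_L k (scale (coord_L n x) (L n) + scale (coord_I n x) (I n))" for k
      using l[of k] by (cases "k = n") auto
    show "coord_I k x = coord_I k (scale (coord_L n x) (L n) + scale (coord_I n x) (I n))" for k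
      using i[of k] by (cases "k = n") auto
  qed
qed

section \<open>Derivations of \<open>W\<close> modulo inner ones\<close>

abbreviation "Der \<equiv> derivations scale br scale br"
abbreviation "Inn \<equiv> inner_derivations scale br scale br"

lemma derivation_iff_adjoint:
  "E \<in> Der \<longleftrightarrow> (\<forall>x y. E (x + y) = E x + E y) \<and> (\<forall>c x. E (scale c x) = scale c (E x)) \<and>
     (\<forall>x y. E (br x y) = br x (E y) - br y (E x))"
  using lie_module.derivation_iff[OF adjoint_module] .

text \<open>The product rule is the Jacobi identity, read as the module law of the adjoint
  module.\<close>

lemma ad_derivation: "(\<lambda>x. br x w) \<in> Der"
  unfolding derivation_iff_adjoint
proof (intro conjI allI)
  fix x y
  show "br (br x y) w = br x (br y w) - br y (br x w)"
    by (rule lie_module.act_bracket[OF adjoint_module])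
qed (simp_all add: br_simps)

lemma inner_iff: "E \<in> Inn \<longleftrightarrow> (\<exists>w. E = (\<lambda>x. br x w))"
  by (auto simp: inner_derivations_def ad_derivation simp flip: fun_eq_iff)

lemma derivation_0: "E \<in> Der \<Longrightarrow> E 0 = 0"
  unfolding derivation_iff_adjoint by (metis add_cancel_right_left)

lemma derivation_eqI:
  assumes "E \<in> Der" "F \<in> Der" "\<And>m. E (L m) = F (L m)" "\<And>m. E (I m) = F (I m)"
  shows "E = F"
proof
  fix x
  show "E x = F x"
    using assms by (induction x rule: W_induct) (simp_all add: derivation_iff_adjoint derivation_0)
qed

lemma derivation_sub_ad: "E \<in> Der \<Longrightarrow> (\<lambda>x. E x - br x w) \<in> Der"
  using ad_derivation[of "- w"] lie_module.derivations_closed(2)[OF adjoint_module, of E "\<lambda>x. br x (- w)"]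
  by (simp add: br_simps)

lemma derivation_modulo_inner_kills_L:
  assumes E: "E \<in> Der"
  obtains w where "\<And>m. E (L m) = br (L m) w"
proof -
  obtain w a b where w: "E (L 0) = br (L 0) w + scale a (L 0) + scale b (I 0)"
    using ad_L0_decomposition by blast
  define F where "F = (\<lambda>x. E x - br x w)"
  have F: "F \<in> Der" unfolding F_def by (rule derivation_sub_ad[OF E])
  have F0: "F (L 0) = scale a (L 0) + scale b (I 0)" by (simp add: F_def w)
  note der = F[unfolded derivation_iff_adjoint]
  \<comment> \<open>Apply \<open>F\<close> to \<open>[L\<^sub>0, L\<^sub>n] = -n L\<^sub>n\<close>;
    the value of \<open>F\<close> at \<open>L\<^sub>0\<close> accounts for the two extra
    terms.\<close>
  have "br (L 0) (F (L n)) = scale (- of_int n) (F (L n)) + scale (of_int n * a) (L n)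
      + scale (of_int n * b) (I n)" for n
  proof -
    have "scale (- of_int n) (F (L n)) = F (br (L 0) (L n))" by (simp add: br_L_L der del: scale_minus_left)
    also have "\<dots> = br (L 0) (F (L n)) - br (L n) (F (L 0))" using der by blast
    also have "br (L n) (F (L 0)) = scale (of_int n * a) (L n) + scale (of_int n * b) (I n)"
      by (simp add: F0 br_simps br_L_L br_L_I mult.commute)
    finally show ?thesis by (simp add: algebra_simps)
  qed
  note eigen = ad_L0_eigenvector[OF this]
  define p q where "p n = coord_L n (F (L n))" and "q n = coord_I n (F (L n))" for n
  have FL: "F (L n) = scale (p n) (L n) + scale (q n) (I n)" for n
    unfolding p_def q_def by (rule eigen(3))
  have pq: "p (m + n) = p m + p n \<and> q (m + n) = q m + q n" if "m \<noteq> n" for m n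
  proof -
    have "scale (of_int (m - n)) (F (L (m + n))) = F (br (L m) (L n))" by (simp add: br_L_L der)
    also have "\<dots> = br (L m) (F (L n)) - br (L n) (F (L m))" using der by blast
    finally have *: "scale (of_int (m - n)) (F (L (m + n))) = br (L m) (F (L n)) - br (L n) (F (L m))" .
    have "of_int (m - n) * p (m + n) = of_int (m - n) * (p m + p n)"
      using arg_cong[OF *, of "coord_L (m + n)"]
      by (simp add: FL br_simps br_L_L br_L_I add.commute) (simp add: algebra_simps)
    moreover have "of_int (m - n) * q (m + n) = of_int (m - n) * (q m + q n)"
      using arg_cong[OF *, of "coord_I (m + n)"]
      by (simp add: FL br_simps br_L_L br_L_I add.commute) (simp add: algebra_simps)
    ultimately show ?thesis using that by (simp del: of_int_diff)
  qed
  have p: "p n = of_int n * p 1" and q: "q n = of_int n * q 1" for n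
    using int_partial_additive[of p n] int_partial_additive[of q n] pq by simp_all
  show ?thesis
  proof
    fix m
    \<comment> \<open>Bracketing \<open>L\<^sub>m\<close> with \<open>L\<^sub>0\<close> or
      \<open>I\<^sub>0\<close> gives \<open>m L\<^sub>m\<close> or \<open>m I\<^sub>m\<close>, so
      the slopes \<open>p 1\<close> and \<open>q 1\<close> are the right coefficients.\<close>
    have "F (L m) = br (L m) (scale (p 1) (L 0) + scale (q 1) (I 0))"
      by (subst FL, subst p, subst q) (simp add: br_simps br_L_L br_L_I mult.commute)
    then show "E (L m) = br (L m) (w + (scale (p 1) (L 0) + scale (q 1) (I 0)))"
      by (simp add: F_def br_simps(3) algebra_simps)
  qed
qed

text \<open>Such an \<open>F\<close> commutes with every \<open>ad L\<^sub>m\<close>, so its value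
  at \<open>I\<^sub>0\<close> propagates to \<open>I\<^sub>m\<close> through
  \<open>[L\<^sub>m, I\<^sub>0] = m I\<^sub>m\<close>.\<close>

lemma derivation_killing_L:
  assumes F: "F \<in> Der" and FL: "\<And>m. F (L m) = 0"
  obtains c where "\<And>m. F (I m) = scale c (I m)"
proof -
  note der = F[unfolded derivation_iff_adjoint]
  have L: "scale (of_int (m - n)) (F (I (m + n))) = br (L m) (F (I n))" for m n
  proof -
    have "scale (of_int (m - n)) (F (I (m + n))) = F (br (L m) (I n))" by (simp add: br_L_I der)
    also have "\<dots> = br (L m) (F (I n)) - br (I n) (F (L m))" using der by blast
    finally show ?thesis by (simp add: FL)
  qed
  have "br (L 0) (F (I n)) = scale (- of_int n) (F (I n)) + scale 0 (L n) + scale 0 (I n)" for n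
    using L[of 0 n] by simp
  note eigen = ad_L0_eigenvector(3)[OF this]
  define p q where "p = coord_L 0 (F (I 0))" and "q = coord_I 0 (F (I 0))"
  have F0: "F (I 0) = scale p (L 0) + scale q (I 0)" unfolding p_def q_def by (rule eigen)
  have FI: "F (I m) = scale p (L m) + scale q (I m)" for m
  proof (cases "m = 0")
    case False
    have "scale (of_int m) (F (I m)) = scale (of_int m) (scale p (L m) + scale q (I m))"
      using L[of m 0] by (simp add: F0 br_simps br_L_L br_L_I scale_right_distrib mult.commute)
    then show ?thesis using False by (simp only: scale_cancel_left of_int_eq_0_iff) simp
  qed (simp add: F0)
  have "F (br (I 1) (I 0)) = br (I 1) (F (I 0)) - br (I 0) (F (I 1))" using der by blast
  then have "coord_I 1 (br (I 1) (F (I 0)) - br (I 0) (F (I 1))) = 0"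
    by (simp add: br_I_I derivation_0[OF F])
  \<comment> \<open>The two brackets contribute \<open>p\<close> and \<open>-p\<close> to the
    \<open>I\<^sub>1\<close> coordinate, so \<open>2 p = 0\<close>.\<close>
  then have "p = 0" by (simp add: FI br_simps br_I_I br_I_L)
  then have "F (I m) = scale q (I m)" for m using FI[of m] by simp
  then show ?thesis by (rule that)
qed

text \<open>Give each \<open>L\<^sub>m\<close> degree 0 and each \<open>I\<^sub>m\<close> degree 1.
  The bracket respects this grading, as \<open>[I\<^sub>m, I\<^sub>n] = 0\<close>, and
  multiplication by the degree is a derivation.\<close>

lemma derivation_D_exists:
  obtains D where "D \<in> Der" "\<And>m. D (L m) = 0" "\<And>m. D (I m) = I m"
proof -
  interpret pair: vector_space_pair scale scale ..
  define g where "g x = (if x \<in> range L then 0 else x)" for x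
  obtain D where D: "Vector_Spaces.linear scale scale D"
    and Dg: "\<forall>x\<in>range L \<union> range I. D x = g x"
    using pair.linear_independent_extend[OF basis_independent] by metis
  have DL: "D (L m) = 0" and DI: "D (I m) = I m" for m
    using Dg L_neq_I by (auto simp: g_def)
  have lin: "D (x + y) = D x + D y" "D (scale c x) = scale c (D x)" for x y c
    using D by (simp_all add: Vector_Spaces.linear_iff)
  have D0: "D 0 = 0" using lin(1)[of 0 0] by simp
  have D_diff: "D (x - y) = D x - D y" for x y using lin(1)[of "x - y" y] by simp
  note simps = br_simps lin D_diff DL DI D0 br_L_L br_L_I br_I_L br_I_I
  \<comment> \<open>The product rule is bilinear: first fix a basis vector on the left and induct on
    \<open>y\<close>, then induct on \<open>x\<close>.\<close>
  have L: "D (br (L m) y) = br (L m) (D y) - br y (D (L m))" for m y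
    by (induction y rule: W_induct) (simp_all add: simps)
  have I: "D (br (I m) y) = br (I m) (D y) - br y (D (I m))" for m y
    by (induction y rule: W_induct) (simp_all add: simps algebra_simps)
  have "D (br x y) = br x (D y) - br y (D x)" for x y
    by (induction x rule: W_induct)
       (simp_all add: lin br_simps D0 L I scale_right_diff_distrib algebra_simps)
  then have "D \<in> Der" by (simp add: derivation_iff_adjoint lin)
  then show thesis using that DL DI by blast
qed

end

section \<open>Basis and dimension of the first cohomology\<close>

theorem theorem3p7:
  fixes scale :: "complex \<Rightarrow> 'w::ab_group_add \<Rightarrow> 'w"
    and br :: "'w \<Rightarrow> 'w \<Rightarrow> 'w"
    and L I :: "int \<Rightarrow> 'w"
  assumes "W_algebra scale br L I"
  shows "\<exists>D \<in> derivations scale br scale br.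
           (\<forall>m. D (L m) = 0) \<and> (\<forall>m. D (I m) = I m) \<and>
           vectorspace.basis class_ring (H1 scale br scale br) {H1_class scale br scale br D} \<and>
           vectorspace.dim class_ring (H1 scale br scale br) = 1"
proof -
  interpret W_algebra scale br L I by (rule assms)
  let ?V = "derivation_space scale br scale br"
  let ?H = "H1 scale br scale br"
  let ?cl = "H1_class scale br scale br"
  note adj = adjoint_module
  note V_simps = lie_module.derivation_space_simps[OF adj]
  note sub = lie_module.inner_derivations_subspace[OF adj]
  interpret A: abelian_subgroup Inn ?V by (rule subspace_abelian_subgroup[OF sub])
  interpret H: vectorspace class_ring ?H by (rule lie_module.H1_vectorspace[OF adj])
  obtain D where D: "D \<in> Der" and DL: "\<And>m. D (L m) = 0" and DI: "\<And>m. D (I m) = I m"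
    by (rule derivation_D_exists) blast
  have carrier: "carrier ?H = {?cl E |E. E \<in> Der}"
    by (auto simp: H1_def H1_class_def quotient_space_simps A_RCOSETS_def' V_simps)
  have zero: "\<zero>\<^bsub>?H\<^esub> = Inn" by (simp add: H1_def quotient_space_simps)
  have smult: "c \<odot>\<^bsub>?H\<^esub> ?cl E = ?cl (\<lambda>x. scale c (E x))" if "E \<in> Der" for c E
    using quotient_smult_coset[OF sub, of c E] that by (simp add: H1_def H1_class_def V_simps)
  have "D \<notin> Inn"
  proof
    assume "D \<in> Inn"
    then obtain w where "D = (\<lambda>x. br x w)" by (auto simp: inner_iff)
    then have "br (I 0) w = I 0" using DI by metis
    then show False using coord_br_I0[of w] by simp
  qed
  \<comment> \<open>A zero class would be the coset \<open>Inn\<close> itself, which would then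
    contain \<open>D\<close>.\<close>
  moreover have "D \<in> ?cl D"
    using A.a_rcos_self[of D] D by (simp add: H1_class_def V_simps)
  ultimately have nz: "?cl D \<noteq> \<zero>\<^bsub>?H\<^esub>" unfolding zero by blast
  have gen: "\<exists>c\<in>carrier class_ring. X = c \<odot>\<^bsub>?H\<^esub> ?cl D" if X_mem: "X \<in> carrier ?H" for X
  proof -
    obtain E where E: "E \<in> Der" and X: "X = ?cl E" using X_mem unfolding carrier by blast
    obtain w where w: "\<And>m. E (L m) = br (L m) w"
      using derivation_modulo_inner_kills_L[OF E] by blast
    have F: "(\<lambda>x. E x - br x w) \<in> Der" by (rule derivation_sub_ad[OF E])
    obtain c where c: "\<And>m. E (I m) - br (I m) w = scale c (I m)"
      using derivation_killing_L[OF F] w by auto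
    have cD: "(\<lambda>x. scale c (D x)) \<in> Der"
      using lie_module.derivations_closed(3)[OF adj D] .
    have "(\<lambda>x. E x - br x w) = (\<lambda>x. scale c (D x))"
      by (rule derivation_eqI[OF F cD]) (simp_all add: w c DL DI)
    \<comment> \<open>\<open>E\<close> is an inner derivation plus \<open>c D\<close>, so it lies in
      the coset of \<open>c D\<close>.\<close>
    then have "E = (\<lambda>x. br x w + scale c (D x))" by (simp add: fun_eq_iff algebra_simps)
    moreover have "(\<lambda>x. br x w) \<in> Inn" using inner_iff by blast
    ultimately have "E \<in> ?cl (\<lambda>x. scale c (D x))"
      by (auto simp: H1_class_def a_r_coset_def' V_simps)
    then have "?cl (\<lambda>x. scale c (D x)) = ?cl E"
      unfolding H1_class_def using cD by (intro A.a_repr_independence') (simp_all add: V_simps)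
    then show ?thesis using smult[OF D, of c] X by (intro bexI[of _ c]) simp_all
  qed
  have "?cl D \<in> carrier ?H" using D by (auto simp: carrier)
  from H.basis_singletonI[OF this nz gen] D DL DI show ?thesis by blast
qed

end
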